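(* Let $A$ be a Banach algebra and $c\in A$. Then the following hold. (i) If $A^{**}=cA^{**}$ and $c$ has the $LW^*W$-property, then $A$ is Arens regular. (ii) If $A^{**}=A^{**}c$ and $c$ has the $RW^*W$-property, then $A$ is Arens regular. (iii) If $A^*=A^*c$ and $c$ has the $LW^*W$-property, then $A^{**}c\subseteq Z_1\cap Z_2$ and $cA^*\subseteq wap(A)\subseteq A^*c$. (iv) If $A^*=cA^*$ and $c$ has the $RW^*W$-property, then $cA^{**}\subseteq Z_1\cap Z_2$ and $A^*c\subseteq wap(A)\subseteq cA^*$.
   Context: $A$ is regarded as a subspace of $A^{**}$. For $a,b\in A$, $f\in A^*$, $F,G\in A^{**}$, the first Arens product is defined by $\langle f.a,b\rangle=\langle f,ab\rangle$, $\langle F.f,a\rangle=\langle F,f.a\rangle$, $\langle F.G,f\rangle=\langle F,G.f\rangle$; the second by $\langle a\circ f,b\rangle=\langle f,ba\rangle$, $\langle f\circ F,a\rangle=\langle F,a\circ f\rangle$, $\langle F\circ G,f\rangle=\langle G,f\circ F\rangle$. Write $a.f=af=a\circ f$ and $fa=f.a$; so $cA^*=\{c\circ f:f\in A^*\}$, $A^*c=\{f.c:f\in A^*\}$, $cA^{**}=\{c.F:F\in A^{**}\}$, $A^{**}c=\{F.c:F\in A^{**}\}$. $A$ is Arens regular if $F.G=F\circ G$ for all $F,G\in A^{**}$. Topological centers: $Z_1=\{G\in A^{**}: F\mapsto G.F \text{ is weak}^*\text{-weak}^*\text{ continuous on }A^{**}\}$ and $Z_2=\{G\in A^{**}: F\mapsto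 F\circ G\text{ is weak}^*\text{-weak}^*\text{ continuous on }A^{**}\}$. $wap(A)$ is the set of $f\in A^*$ for which the map $a\mapsto f.a$ from $A$ to $A^*$ is weakly compact. An element $a\in A$ has the $LW^*W$-property if for every net $(f_\alpha)$ in $A^*$, $a.f_\alpha\to0$ weak$^*$ in $A^*$ implies $a.f_\alpha\to 0$ weakly in $A^*$; it has the $RW^*W$-property if for every net $(f_\alpha)$ in $A^*$, $f_\alpha.a\to0$ weak$^*$ implies $f_\alpha.a\to0$ weakly. *)

theory Defs
  imports "HOL-Analysis.Analysis"
begin

(* Associative, not necessarily unital Banach algebras, over the real or the complex field:
   up to isometric isomorphism, these are the only fields of sort {real_normed_field, heine_borel}.
   The type class already makes 'a a Banach algebra over the reals; the extra scalar action
   must extend scaleR.  For real scalars take scale = scaleR. *)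
locale banach_algebra = vector_space scale
  for scale :: "'k::{real_normed_field,heine_borel} \<Rightarrow> 'a::{real_normed_algebra,banach} \<Rightarrow> 'a" +
  assumes scale_of_real: "scale (of_real r) x = r *\<^sub>R x"
    and norm_scale: "norm (scale k x) = norm k * norm x"
    and scale_mult_left: "scale k x * y = scale k (x * y)"
    and scale_mult_right: "x * scale k y = scale k (x * y)"

lemma banach_algebra_real:
  "banach_algebra ((*\<^sub>R) :: real \<Rightarrow> 'a::{real_normed_algebra,banach} \<Rightarrow> 'a)"
  by unfold_locales (simp_all add: algebra_simps)

lemma banach_algebra_complex: "banach_algebra ((*) :: complex \<Rightarrow> complex \<Rightarrow> complex)"
  by unfold_locales (simp_all add: algebra_simps norm_mult scaleR_conv_of_real)

definition dual :: "('k::{real_normed_field,heine_borel} \<Rightarrow> 'a::{real_normed_algebra,banach} \<Rightarrow> 'a) \<Rightarrow> ('a \<Rightarrow> 'k) set"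
  where "dual s = {f. Vector_Spaces.linear s (*) f \<and> bounded_linear f}"

(* Functionals on A* are functions made extensional outside dual s, so that HOL equality of
   elements of bidual s is equality of functionals; onorm is the norm of A*. *)
definition bidual :: "('k::{real_normed_field,heine_borel} \<Rightarrow> 'a::{real_normed_algebra,banach} \<Rightarrow> 'a) \<Rightarrow> (('a \<Rightarrow> 'k) \<Rightarrow> 'k) set"
  where "bidual s = {F \<in> extensional (dual s).
     (\<forall>f\<in>dual s. \<forall>g\<in>dual s. F (\<lambda>x. f x + g x) = F f + F g) \<and>
     (\<forall>k. \<forall>f\<in>dual s. F (\<lambda>x. k * f x) = k * F f) \<and>
     (\<exists>K. \<forall>f\<in>dual s. norm (F f) \<le> K * onorm f)}"

definition canon_embed :: "('k::{real_normed_field,heine_borel} \<Rightarrow> 'a::{real_normed_algebra,banach} \<Rightarrow> 'a) \<Rightarrow> 'a \<Rightarrow> ('a \<Rightarrow> 'k) \<Rightarrow> 'k"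
  where "canon_embed s a = (\<lambda>f\<in>dual s. f a)"

(* ract f a is f.a, and lact a f is a.f (the same as a o f) *)
definition ract :: "('a::times \<Rightarrow> 'k) \<Rightarrow> 'a \<Rightarrow> 'a \<Rightarrow> 'k"
  where "ract f a = (\<lambda>b. f (a * b))"

definition lact :: "'a::times \<Rightarrow> ('a \<Rightarrow> 'k) \<Rightarrow> 'a \<Rightarrow> 'k"
  where "lact a f = (\<lambda>b. f (b * a))"

(* The functionals F.f and f o F of A* *)
definition bidual_lact :: "(('a::times \<Rightarrow> 'k) \<Rightarrow> 'k) \<Rightarrow> ('a \<Rightarrow> 'k) \<Rightarrow> 'a \<Rightarrow> 'k"
  where "bidual_lact F f = (\<lambda>a. F (ract f a))"

definition bidual_ract :: "('a::times \<Rightarrow> 'k) \<Rightarrow> (('a \<Rightarrow> 'k) \<Rightarrow> 'k) \<Rightarrow> 'a \<Rightarrow> 'k"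
  where "bidual_ract f F = (\<lambda>a. F (lact a f))"

definition arens1 :: "('k::{real_normed_field,heine_borel} \<Rightarrow> 'a::{real_normed_algebra,banach} \<Rightarrow> 'a) \<Rightarrow>
    (('a \<Rightarrow> 'k) \<Rightarrow> 'k) \<Rightarrow> (('a \<Rightarrow> 'k) \<Rightarrow> 'k) \<Rightarrow> ('a \<Rightarrow> 'k) \<Rightarrow> 'k"
  where "arens1 s F G = (\<lambda>f\<in>dual s. F (bidual_lact G f))"

definition arens2 :: "('k::{real_normed_field,heine_borel} \<Rightarrow> 'a::{real_normed_algebra,banach} \<Rightarrow> 'a) \<Rightarrow>
    (('a \<Rightarrow> 'k) \<Rightarrow> 'k) \<Rightarrow> (('a \<Rightarrow> 'k) \<Rightarrow> 'k) \<Rightarrow> ('a \<Rightarrow> 'k) \<Rightarrow> 'k"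
  where "arens2 s F G = (\<lambda>f\<in>dual s. G (bidual_ract f F))"

definition arens_regular :: "('k::{real_normed_field,heine_borel} \<Rightarrow> 'a::{real_normed_algebra,banach} \<Rightarrow> 'a) \<Rightarrow> bool"
  where "arens_regular s \<longleftrightarrow> (\<forall>F\<in>bidual s. \<forall>G\<in>bidual s. arens1 s F G = arens2 s F G)"

definition weakstar_dual :: "('k::{real_normed_field,heine_borel} \<Rightarrow> 'a::{real_normed_algebra,banach} \<Rightarrow> 'a) \<Rightarrow> ('a \<Rightarrow> 'k) topology"
  where "weakstar_dual s = subtopology (product_topology (\<lambda>_. euclidean) UNIV) (dual s)"

(* The coarsest topology on A* making every element of A** continuous *)
definition weak_dual :: "('k::{real_normed_field,heine_borel} \<Rightarrow> 'a::{real_normed_algebra,banach} \<Rightarrow> 'a) \<Rightarrow> ('a \<Rightarrow> 'k) topology"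
  where "weak_dual s = pullback_topology (dual s) (\<lambda>f. \<lambda>F\<in>bidual s. F f)
     (product_topology (\<lambda>_. euclidean) (bidual s))"

definition weakstar_bidual :: "('k::{real_normed_field,heine_borel} \<Rightarrow> 'a::{real_normed_algebra,banach} \<Rightarrow> 'a) \<Rightarrow> (('a \<Rightarrow> 'k) \<Rightarrow> 'k) topology"
  where "weakstar_bidual s = subtopology (product_topology (\<lambda>_. euclidean) (dual s)) (bidual s)"

definition Z1 :: "('k::{real_normed_field,heine_borel} \<Rightarrow> 'a::{real_normed_algebra,banach} \<Rightarrow> 'a) \<Rightarrow> (('a \<Rightarrow> 'k) \<Rightarrow> 'k) set"
  where "Z1 s = {G \<in> bidual s. continuous_map (weakstar_bidual s) (weakstar_bidual s) (\<lambda>F. arens1 s G F)}"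

definition Z2 :: "('k::{real_normed_field,heine_borel} \<Rightarrow> 'a::{real_normed_algebra,banach} \<Rightarrow> 'a) \<Rightarrow> (('a \<Rightarrow> 'k) \<Rightarrow> 'k) set"
  where "Z2 s = {G \<in> bidual s. continuous_map (weakstar_bidual s) (weakstar_bidual s) (\<lambda>F. arens2 s F G)}"

(* Weak compactness of an operator T from A to A*: the image of the closed unit ball is
   relatively weakly compact. *)
definition weakly_compact_operator :: "('k::{real_normed_field,heine_borel} \<Rightarrow> 'a::{real_normed_algebra,banach} \<Rightarrow> 'a) \<Rightarrow> ('a \<Rightarrow> 'a \<Rightarrow> 'k) \<Rightarrow> bool"
  where "weakly_compact_operator s T \<longleftrightarrow> compactin (weak_dual s) (weak_dual s closure_of (T ` cball 0 1))"

definition wap :: "('k::{real_normed_field,heine_borel} \<Rightarrow> 'a::{real_normed_algebra,banach} \<Rightarrow> 'a) \<Rightarrow> ('a \<Rightarrow> 'k) set"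
  where "wap s = {f \<in> dual s. weakly_compact_operator s (\<lambda>a. ract f a)}"

(* Nets in A* are rendered by filters on A*: a net gives the filter generated by its
   tails, and every proper filter arises so (the improper one satisfies the condition trivially).  The lemmas LWsW_net and RWsW_net give the form for a
   family indexed by any type. *)
definition LWsW :: "('k::{real_normed_field,heine_borel} \<Rightarrow> 'a::{real_normed_algebra,banach} \<Rightarrow> 'a) \<Rightarrow> 'a \<Rightarrow> bool"
  where "LWsW s a \<longleftrightarrow> (\<forall>N. N \<le> principal (dual s) \<longrightarrow>
     limitin (weakstar_dual s) (\<lambda>f. lact a f) (\<lambda>_. 0) N \<longrightarrow>
     limitin (weak_dual s) (\<lambda>f. lact a f) (\<lambda>_. 0) N)"

definition RWsW :: "('k::{real_normed_field,heine_borel} \<Rightarrow> 'a::{real_normed_algebra,banach} \<Rightarrow> 'a) \<Rightarrow> 'a \<Rightarrow> bool"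
  where "RWsW s a \<longleftrightarrow> (\<forall>N. N \<le> principal (dual s) \<longrightarrow>
     limitin (weakstar_dual s) (\<lambda>f. ract f a) (\<lambda>_. 0) N \<longrightarrow>
     limitin (weak_dual s) (\<lambda>f. ract f a) (\<lambda>_. 0) N)"

lemma LWsW_net:
  assumes "LWsW s a" "\<forall>\<^sub>F i in I. x i \<in> dual s"
    and "limitin (weakstar_dual s) (\<lambda>i. lact a (x i)) (\<lambda>_. 0) I"
  shows "limitin (weak_dual s) (\<lambda>i. lact a (x i)) (\<lambda>_. 0) I"
proof -
  have "filtermap x I \<le> principal (dual s)"
    using assms(2) by (simp add: le_principal eventually_filtermap)
  then show ?thesis
    using assms(1,3) unfolding LWsW_def limitin_def
    by (auto simp: eventually_filtermap dest!: spec[of _ "filtermap x I"])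
qed

lemma RWsW_net:
  assumes "RWsW s a" "\<forall>\<^sub>F i in I. x i \<in> dual s"
    and "limitin (weakstar_dual s) (\<lambda>i. ract (x i) a) (\<lambda>_. 0) I"
  shows "limitin (weak_dual s) (\<lambda>i. ract (x i) a) (\<lambda>_. 0) I"
proof -
  have "filtermap x I \<le> principal (dual s)"
    using assms(2) by (simp add: le_principal eventually_filtermap)
  then show ?thesis
    using assms(1,3) unfolding RWsW_def limitin_def
    by (auto simp: eventually_filtermap dest!: spec[of _ "filtermap x I"])
qed

end

theory Submission
  imports Defs
begin

text \<open>
  The property LW*W of c says that f \<mapsto> F(c.f) is weak* continuous for every F in the bidual,
  hence is evaluation at an element of A; that is, F.c lies in A.  Symmetrically, RW*W forces
  c.F to lie in A.  Since elements of A multiply the bidual in the same way for both Arens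
  products, and lie in both topological centers, associativity gives (i), (ii) and the first
  halves of (iii), (iv).  For the inclusions into wap(A), the same observation yields
  \<Phi>(\<Psi>.f) = \<Psi>(f\<circ>\<Phi>) for all \<Phi>, \<Psi> in the bidual, so that \<Phi> \<mapsto> f\<circ>\<Phi> is weak*-weakly
  continuous and maps the weak* compact unit ball of the bidual onto a weakly compact set
  containing f.a for all a in the unit ball of A.
\<close>

section \<open>Linear algebra: combinations of finitely many evaluations\<close>

text \<open>A functional that kills the common kernel of finitely many functionals lies in their
  span. Induction on \<open>E\<close>: either evaluation at the new point already vanishes on the
  common zeros of \<open>E\<close> and gets coefficient 0, or a multiple of it can be subtracted
  from \<open>p\<close> so that the induction hypothesis applies to the difference.\<close>

lemma functional_in_span_of_evaluations:
  fixes S :: "('b \<Rightarrow> 'k::field) set" and p :: "('b \<Rightarrow> 'k) \<Rightarrow> 'k"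
  assumes "finite E"
    and S_add: "\<And>f g. f \<in> S \<Longrightarrow> g \<in> S \<Longrightarrow> (\<lambda>x. f x + g x) \<in> S"
    and S_scale: "\<And>k f. f \<in> S \<Longrightarrow> (\<lambda>x. k * f x) \<in> S"
    and "\<And>f g. f \<in> S \<Longrightarrow> g \<in> S \<Longrightarrow> p (\<lambda>x. f x + g x) = p f + p g"
    and "\<And>k f. f \<in> S \<Longrightarrow> p (\<lambda>x. k * f x) = k * p f"
    and "\<And>f. f \<in> S \<Longrightarrow> \<forall>a\<in>E. f a = 0 \<Longrightarrow> p f = 0"
  shows "\<exists>u. \<forall>f\<in>S. p f = (\<Sum>a\<in>E. u a * f a)"
  using assms(1,4-6)
proof (induction E arbitrary: p rule: finite_induct)
  case empty
  then show ?case by auto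
next
  case (insert a E)
  show ?case
  proof (cases "\<forall>f\<in>S. (\<forall>b\<in>E. f b = 0) \<longrightarrow> f a = 0")
    case True
    then have "\<exists>u. \<forall>f\<in>S. p f = (\<Sum>b\<in>E. u b * f b)"
      by (intro insert.IH insert.prems) auto
    then obtain u where u: "\<forall>f\<in>S. p f = (\<Sum>b\<in>E. u b * f b)" ..
    have "p f = (\<Sum>b\<in>insert a E. (u(a := 0)) b * f b)" if "f \<in> S" for f
    proof -
      have "(\<Sum>b\<in>E. (u(a := 0)) b * f b) = (\<Sum>b\<in>E. u b * f b)"
        using insert.hyps by (intro sum.cong) auto
      then show ?thesis
        using u that insert.hyps by simp
    qed
    then show ?thesis by blast
  next
    case False
    then obtain h where h: "h \<in> S" "\<forall>b\<in>E. h b = 0" "h a \<noteq> 0"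
      by blast
    define g where "g = (\<lambda>x. inverse (h a) * h x)"
    have g: "g \<in> S" "\<forall>b\<in>E. g b = 0" "g a = 1"
      using h S_scale[OF h(1)] by (auto simp: g_def)
    \<comment> \<open>The multiple of evaluation at \<open>a\<close> is chosen so that
      \<open>q g = 0\<close>; thus \<open>p g\<close> is the coefficient of the new point.\<close>
    define q where "q f = p f - p g * f a" for f
    have "\<exists>u. \<forall>f\<in>S. q f = (\<Sum>b\<in>E. u b * f b)"
    proof (rule insert.IH)
      fix f assume f: "f \<in> S" "\<forall>b\<in>E. f b = 0"
      \<comment> \<open>Projecting \<open>f\<close> along \<open>g\<close> makes it vanish at
        \<open>a\<close> too, without disturbing its zeros on \<open>E\<close>; then
        \<open>p f' = 0\<close> is exactly \<open>q f = 0\<close>.\<close>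
      define f' where "f' = (\<lambda>x. f x + (- f a) * g x)"
      have f': "f' \<in> S"
        unfolding f'_def by (intro S_add S_scale f g)
      have "\<forall>b\<in>insert a E. f' b = 0"
        using f g by (simp add: f'_def)
      then have "p f' = 0"
        using insert.prems(3) f' by blast
      moreover have "p f' = p f + (- f a) * p g"
        unfolding f'_def insert.prems(1)[OF f(1) S_scale[OF g(1)]] insert.prems(2)[OF g(1)] ..
      ultimately show "q f = 0"
        by (simp add: q_def algebra_simps)
    next
      show "q (\<lambda>x. f x + g x) = q f + q g" if "f \<in> S" "g \<in> S" for f g
        unfolding q_def insert.prems(1)[OF that] by (simp add: algebra_simps)
      show "q (\<lambda>x. k * f x) = k * q f" if "f \<in> S" for k f
        unfolding q_def insert.prems(2)[OF that] by (simp add: algebra_simps)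
    qed
    then obtain u where u: "\<forall>f\<in>S. q f = (\<Sum>b\<in>E. u b * f b)" ..
    have "p f = (\<Sum>b\<in>insert a E. (u(a := p g)) b * f b)" if "f \<in> S" for f
    proof -
      have "(\<Sum>b\<in>E. (u(a := p g)) b * f b) = (\<Sum>b\<in>E. u b * f b)"
        using insert.hyps by (intro sum.cong) auto
      then show ?thesis
        using u that insert.hyps by (simp add: q_def algebra_simps)
    qed
    then show ?thesis by blast
  qed
qed

section \<open>The weak topology of the dual and the weak* topology of the bidual\<close>

text \<open>In a Hausdorff space the compact set \<open>K\<close> is closed, so the closure of the
  image stays inside \<open>K\<close> and is compact as a closed subset of it.\<close>

lemma weakly_compact_operatorI:
  assumes "Hausdorff_space (weak_dual s)" "compactin (weak_dual s) K" "T ` cball 0 1 \<subseteq> K"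
  shows "weakly_compact_operator s T"
  unfolding weakly_compact_operator_def
  using assms
  by (meson closed_compactin closedin_closure_of closure_of_minimal compactin_imp_closedin)

lemma continuous_map_weak_dual_eval:
  assumes "F \<in> bidual s"
  shows "continuous_map (weak_dual s) euclidean F"
proof -
  have "continuous_map (weak_dual s) euclidean ((\<lambda>x. x F) \<circ> (\<lambda>f. \<lambda>F\<in>bidual s. F f))"
    unfolding weak_dual_def
    by (intro continuous_map_pullback continuous_map_product_projection assms)
  then show ?thesis
    using assms by (simp add: o_def)
qed

lemma topspace_weak_dual [simp]: "topspace (weak_dual s) = dual s"
  by (auto simp: weak_dual_def topspace_pullback_topology)

lemma continuous_map_into_weak_dual:
  assumes "\<And>x. x \<in> topspace X \<Longrightarrow> T x \<in> dual s"
    and "\<And>F. F \<in> bidual s \<Longrightarrow> continuous_map X euclidean (\<lambda>x. F (T x))"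
  shows "continuous_map X (weak_dual s) T"
  unfolding weak_dual_def
proof (rule continuous_map_pullback')
  show "continuous_map X (product_topology (\<lambda>_. euclidean) (bidual s)) ((\<lambda>f. \<lambda>F\<in>bidual s. F f) \<circ> T)"
    using assms(2) by (auto simp: continuous_map_componentwise)
qed (use assms(1) in auto)

text \<open>The points of the product over \<open>dual s\<close> are the functions extensional
  there, and the definition of \<open>bidual\<close> makes all its elements such functions.\<close>

lemma topspace_weakstar_bidual [simp]: "topspace (weakstar_bidual s) = bidual s"
  by (auto simp: weakstar_bidual_def bidual_def PiE_def)

lemma continuous_map_weakstar_bidual_eval:
  assumes "f \<in> dual s"
  shows "continuous_map (weakstar_bidual s) euclidean (\<lambda>F. F f)"
  unfolding weakstar_bidual_def
  by (intro continuous_map_from_subtopology continuous_map_product_projection assms)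

lemma continuous_map_into_weakstar_bidual:
  assumes "\<And>x. x \<in> topspace X \<Longrightarrow> T x \<in> bidual s"
    and "\<And>f. f \<in> dual s \<Longrightarrow> continuous_map X euclidean (\<lambda>x. T x f)"
  shows "continuous_map X (weakstar_bidual s) T"
  using assms unfolding weakstar_bidual_def continuous_map_in_subtopology
  by (auto simp: continuous_map_componentwise bidual_def)

section \<open>Pointwise rules for the actions on functionals\<close>

lemma canon_embed_apply [simp]: "f \<in> dual s \<Longrightarrow> canon_embed s a f = f a"
  by (simp add: canon_embed_def)

lemma ract_apply: "ract f a b = f (a * b)"
  by (simp add: ract_def)

lemma lact_apply: "lact a f b = f (b * a)"
  by (simp add: lact_def)

lemma ract_ract: "ract (ract f a) b = ract f (a * b)" for f :: "'a::semigroup_mult \<Rightarrow> 'k"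
  by (simp add: ract_def mult.assoc)

lemma lact_lact: "lact a (lact b f) = lact (a * b) f" for f :: "'a::semigroup_mult \<Rightarrow> 'k"
  by (simp add: lact_def mult.assoc)

lemma ract_lact: "ract (lact a f) b = lact a (ract f b)" for f :: "'a::semigroup_mult \<Rightarrow> 'k"
  by (simp add: lact_def ract_def mult.assoc)

lemma bidual_lact_apply: "bidual_lact F f a = F (ract f a)"
  by (simp add: bidual_lact_def)

lemma bidual_ract_apply: "bidual_ract f F a = F (lact a f)"
  by (simp add: bidual_ract_def)

context banach_algebra
begin

section \<open>Linearity and norm bounds in the dual and the bidual\<close>

lemma dualI:
  assumes "\<And>x y. f (x + y) = f x + f y" "\<And>k x. f (scale k x) = k * f x"
    and "\<And>x. norm (f x) \<le> K * norm x"
  shows "f \<in> dual scale"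
proof -
  interpret l: Vector_Spaces.linear scale "(*)" f
    by unfold_locales (simp_all add: assms algebra_simps)
  have "bounded_linear f"
  proof (rule bounded_linear_intro)
    show "f (r *\<^sub>R x) = r *\<^sub>R f x" for r x
      using assms(2)[of "of_real r" x] by (simp add: scale_of_real scaleR_conv_of_real)
  qed (use assms in \<open>auto simp: mult.commute\<close>)
  then show ?thesis
    using l.linear_axioms by (simp add: dual_def)
qed

lemma dual_add: "f \<in> dual scale \<Longrightarrow> f (x + y) = f x + f y"
  and dual_scale: "f \<in> dual scale \<Longrightarrow> f (scale k x) = k * f x"
  and dual_norm: "f \<in> dual scale \<Longrightarrow> norm (f x) \<le> onorm f * norm x"
  and onorm_dual_nonneg: "f \<in> dual scale \<Longrightarrow> 0 \<le> onorm f"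
  by (auto simp: dual_def Vector_Spaces.linear_def module_hom_def module_hom_axioms_def
      onorm onorm_pos_le)

lemma dual_zero: "f \<in> dual scale \<Longrightarrow> f 0 = 0"
  using dual_add[of f 0 0] by simp

lemma dual_sum: "f \<in> dual scale \<Longrightarrow> f (\<Sum>i\<in>I. v i) = (\<Sum>i\<in>I. f (v i))"
  by (induction I rule: infinite_finite_induct) (simp_all add: dual_zero dual_add)

lemma dual_plus:
  assumes "f \<in> dual scale" "g \<in> dual scale"
  shows "(\<lambda>x. f x + g x) \<in> dual scale"
proof (rule dualI)
  show "norm (f x + g x) \<le> (onorm f + onorm g) * norm x" for x
    using norm_triangle_ineq[of "f x" "g x"] dual_norm[OF assms(1), of x] dual_norm[OF assms(2), of x]
    by (simp add: algebra_simps)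
qed (use assms in \<open>simp_all add: dual_add dual_scale algebra_simps\<close>)

lemma dual_mult:
  assumes "f \<in> dual scale"
  shows "(\<lambda>x. k * f x) \<in> dual scale"
proof (rule dualI)
  show "norm (k * f x) \<le> (norm k * onorm f) * norm x" for x
    using mult_left_mono[OF dual_norm[OF assms, of x], of "norm k"]
    by (simp add: norm_mult mult.assoc)
qed (use assms in \<open>simp_all add: dual_add dual_scale algebra_simps\<close>)

lemma dual_0: "(\<lambda>_. 0) \<in> dual scale"
  by (rule dualI[where K = 0]) auto

lemma norm_ract_le:
  assumes "f \<in> dual scale"
  shows "norm (ract f a x) \<le> (onorm f * norm a) * norm x"
  using order_trans[OF dual_norm[OF assms, of "a * x"]
      mult_left_mono[OF norm_mult_ineq[of a x] onorm_dual_nonneg[OF assms]]]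
  by (simp add: ract_def mult.assoc)

lemma norm_lact_le:
  assumes "f \<in> dual scale"
  shows "norm (lact a f x) \<le> (onorm f * norm a) * norm x"
  using order_trans[OF dual_norm[OF assms, of "x * a"]
      mult_left_mono[OF norm_mult_ineq[of x a] onorm_dual_nonneg[OF assms]]]
  by (simp add: lact_def ac_simps)

lemma ract_in_dual: "f \<in> dual scale \<Longrightarrow> ract f a \<in> dual scale"
  by (rule dualI[OF _ _ norm_ract_le])
    (simp_all add: ract_def distrib_left scale_mult_right dual_add dual_scale)

lemma lact_in_dual: "f \<in> dual scale \<Longrightarrow> lact a f \<in> dual scale"
  by (rule dualI[OF _ _ norm_lact_le])
    (simp_all add: lact_def distrib_right scale_mult_left dual_add dual_scale)

lemma onorm_ract_le: "f \<in> dual scale \<Longrightarrow> onorm (ract f a) \<le> onorm f * norm a"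
  by (intro onorm_bound norm_ract_le mult_nonneg_nonneg onorm_dual_nonneg norm_ge_zero)

lemma onorm_lact_le: "f \<in> dual scale \<Longrightarrow> onorm (lact a f) \<le> onorm f * norm a"
  by (intro onorm_bound norm_lact_le mult_nonneg_nonneg onorm_dual_nonneg norm_ge_zero)

lemma bidual_add:
    "F \<in> bidual scale \<Longrightarrow> f \<in> dual scale \<Longrightarrow> g \<in> dual scale \<Longrightarrow> F (\<lambda>x. f x + g x) = F f + F g"
  and bidual_mult: "F \<in> bidual scale \<Longrightarrow> f \<in> dual scale \<Longrightarrow> F (\<lambda>x. k * f x) = k * F f"
  and bidual_extensional: "F \<in> bidual scale \<Longrightarrow> F \<in> extensional (dual scale)"
  by (auto simp: bidual_def)

lemma bidual_zero: "F \<in> bidual scale \<Longrightarrow> F (\<lambda>_. 0) = 0"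
  using bidual_mult[of F "\<lambda>_. 0" 0] dual_0 by simp

text \<open>The definition of \<open>bidual\<close> allows a constant of any sign; a nonnegative one
  is needed to multiply inequalities between operator norms by it.\<close>

lemma bidual_bound:
  assumes "F \<in> bidual scale"
  obtains K where "0 \<le> K" "\<And>f. f \<in> dual scale \<Longrightarrow> norm (F f) \<le> K * onorm f"
proof -
  obtain K where K: "\<And>f. f \<in> dual scale \<Longrightarrow> norm (F f) \<le> K * onorm f"
    using assms unfolding bidual_def by blast
  have "norm (F f) \<le> \<bar>K\<bar> * onorm f" if "f \<in> dual scale" for f
    using K[OF that] mult_right_mono[OF abs_ge_self onorm_dual_nonneg[OF that], of K] by linarith
  then show thesis
    using that[of "\<bar>K\<bar>"] by simp
qed

lemma bidualI:
  assumes "F \<in> extensional (dual scale)"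
    and "\<And>f g. f \<in> dual scale \<Longrightarrow> g \<in> dual scale \<Longrightarrow> F (\<lambda>x. f x + g x) = F f + F g"
    and "\<And>k f. f \<in> dual scale \<Longrightarrow> F (\<lambda>x. k * f x) = k * F f"
    and "\<And>f. f \<in> dual scale \<Longrightarrow> norm (F f) \<le> K * onorm f"
  shows "F \<in> bidual scale"
  using assms unfolding bidual_def by blast

lemma canon_embed_in_bidual: "canon_embed scale a \<in> bidual scale"
  using dual_norm[of _ a]
  by (intro bidualI[where K = "norm a"])
    (simp_all add: dual_plus dual_mult mult.commute[of "norm a"], simp add: canon_embed_def)

lemma bidual_lact_in_dual:
  assumes "F \<in> bidual scale" "f \<in> dual scale"
  shows "bidual_lact F f \<in> dual scale"
proof -
  obtain K where K: "0 \<le> K" "\<And>f. f \<in> dual scale \<Longrightarrow> norm (F f) \<le> K * onorm f"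
    using bidual_bound[OF assms(1)] by blast
  show ?thesis
  proof (rule dualI)
    show "bidual_lact F f (x + y) = bidual_lact F f x + bidual_lact F f y" for x y
    proof -
      have "ract f (x + y) = (\<lambda>z. ract f x z + ract f y z)"
        by (simp add: ract_def distrib_right dual_add assms)
      then show ?thesis
        by (simp add: bidual_lact_def bidual_add assms ract_in_dual)
    qed
    show "bidual_lact F f (scale k x) = k * bidual_lact F f x" for k x
    proof -
      have "ract f (scale k x) = (\<lambda>z. k * ract f x z)"
        by (simp add: ract_def scale_mult_left dual_scale assms)
      then show ?thesis
        by (simp add: bidual_lact_def bidual_mult assms ract_in_dual)
    qed
    show "norm (bidual_lact F f x) \<le> (K * onorm f) * norm x" for x
      using order_trans[OF K(2)[OF ract_in_dual] mult_left_mono[OF onorm_ract_le K(1)]] assms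
      by (simp add: bidual_lact_def mult.assoc)
  qed
qed

lemma bidual_ract_in_dual:
  assumes "F \<in> bidual scale" "f \<in> dual scale"
  shows "bidual_ract f F \<in> dual scale"
proof -
  obtain K where K: "0 \<le> K" "\<And>f. f \<in> dual scale \<Longrightarrow> norm (F f) \<le> K * onorm f"
    using bidual_bound[OF assms(1)] by blast
  show ?thesis
  proof (rule dualI)
    show "bidual_ract f F (x + y) = bidual_ract f F x + bidual_ract f F y" for x y
    proof -
      have "lact (x + y) f = (\<lambda>z. lact x f z + lact y f z)"
        by (simp add: lact_def distrib_left dual_add assms)
      then show ?thesis
        by (simp add: bidual_ract_def bidual_add assms lact_in_dual)
    qed
    show "bidual_ract f F (scale k x) = k * bidual_ract f F x" for k x
    proof -
      have "lact (scale k x) f = (\<lambda>z. k * lact x f z)"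
        by (simp add: lact_def scale_mult_right dual_scale assms)
      then show ?thesis
        by (simp add: bidual_ract_def bidual_mult assms lact_in_dual)
    qed
    show "norm (bidual_ract f F x) \<le> (K * onorm f) * norm x" for x
      using order_trans[OF K(2)[OF lact_in_dual] mult_left_mono[OF onorm_lact_le K(1)]] assms
      by (simp add: bidual_ract_def mult.assoc)
  qed
qed

section \<open>Compactness and a criterion for weak almost periodicity\<close>

text \<open>Evaluations at points of the algebra belong to the bidual, so the weak topology is finer
  than pointwise convergence, which is already Hausdorff.\<close>

lemma Hausdorff_space_weak_dual: "Hausdorff_space (weak_dual scale)"
proof (rule Hausdorff_space_injective_preimage)
  show "Hausdorff_space (product_topology (\<lambda>_. euclidean :: 'k topology) (UNIV :: 'a set))"
    by (simp add: Hausdorff_space_product_topology)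
  have "continuous_map (weak_dual scale) euclidean (\<lambda>f. f a)" for a
    using continuous_map_weak_dual_eval[OF canon_embed_in_bidual[of a]]
    by (rule continuous_map_eq) simp
  then show "continuous_map (weak_dual scale) (product_topology (\<lambda>_. euclidean) UNIV) (\<lambda>f. f)"
    by (simp add: continuous_map_componentwise_UNIV)
qed simp

text \<open>Banach-Alaoglu for the unit ball of the bidual: by Tychonoff the product of the balls of
  radius \<open>onorm f\<close> is compact, and linearity cuts out a closed subset of it.\<close>

lemma compactin_bidual_ball:
  "compactin (weakstar_bidual scale) {F \<in> bidual scale. \<forall>f\<in>dual scale. norm (F f) \<le> onorm f}"
    (is "compactin _ ?B")
proof -
  let ?P = "product_topology (\<lambda>_. euclidean) (dual scale) :: (('a \<Rightarrow> 'k) \<Rightarrow> 'k) topology"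
  define I where "I = dual scale \<times> dual scale \<times> (UNIV :: 'k set)"
  \<comment> \<open>One family of closed conditions encodes linearity: \<open>k = 1\<close> gives
    additivity, and \<open>f = 0\<close> gives homogeneity.\<close>
  define C where "C = (\<lambda>(f, g, k). {F \<in> topspace ?P. F (\<lambda>x. f x + k * g x) = F f + k * F g})"
  have proj: "continuous_map ?P euclidean (\<lambda>F. F f)" if "f \<in> dual scale" for f
    using that by (rule continuous_map_product_projection)
  have proj_mult: "continuous_map ?P euclidean (\<lambda>F. k * F f)" if "f \<in> dual scale" for k f
    using proj[OF that] by (simp add: continuous_map_atin tendsto_mult_left)
  have "closedin ?P {F \<in> topspace ?P. F (\<lambda>x. f x + k * g x) = F f + k * F g}"
    if "f \<in> dual scale" "g \<in> dual scale" for f g k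
    by (intro closedin_continuous_maps_eq[where Y = euclidean] Hausdorff_space_euclidean
        continuous_map_add proj proj_mult dual_plus dual_mult that)
  then have "closedin ?P (C i)" if "i \<in> I" for i
    using that by (auto simp: C_def I_def simp del: topspace_product_topology)
  then have closed: "closedin ?P (\<Inter>i\<in>I. C i)"
    \<comment> \<open>The zero functional shows that the family being intersected is
      nonempty.\<close>
    by (intro closedin_Inter) (auto simp: I_def intro: dual_0)
  have "compactin ?P (PiE (dual scale) (\<lambda>f. cball 0 (onorm f)))"
    by (simp add: compactin_PiE)
  then have "compactin ?P ((PiE (dual scale) (\<lambda>f. cball 0 (onorm f))) \<inter> (\<Inter>i\<in>I. C i))"
    by (rule compact_Int_closedin[OF _ closed])
  moreover have "(PiE (dual scale) (\<lambda>f. cball 0 (onorm f))) \<inter> (\<Inter>i\<in>I. C i) = ?B"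
  proof (intro equalityI subsetI)
    fix F assume F: "F \<in> (PiE (dual scale) (\<lambda>f. cball 0 (onorm f))) \<inter> (\<Inter>i\<in>I. C i)"
    then have *: "F (\<lambda>x. f x + k * g x) = F f + k * F g"
      if "f \<in> dual scale" "g \<in> dual scale" for f g k
      using that by (auto simp: C_def I_def)
    \<comment> \<open>Homogeneity is read off the condition with first functional zero, so
      \<open>F\<close> must be known to vanish there.\<close>
    have 0: "F (\<lambda>_. 0) = 0"
      using *[OF dual_0 dual_0, of 1] by simp
    have "F \<in> bidual scale"
    proof (rule bidualI[where K = 1])
      show "F (\<lambda>x. f x + g x) = F f + F g" if "f \<in> dual scale" "g \<in> dual scale" for f g
        using *[OF that, of 1] by simp
      show "F (\<lambda>x. k * f x) = k * F f" if "f \<in> dual scale" for f k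
        using *[OF dual_0 that, of k] 0 by simp
    qed (use F in \<open>auto simp: PiE_def\<close>)
    then show "F \<in> ?B"
      using F by auto
  next
    fix F assume F: "F \<in> ?B"
    then have "F (\<lambda>x. f x + k * g x) = F f + k * F g" if "f \<in> dual scale" "g \<in> dual scale" for f g k
      using bidual_add[OF _ that(1) dual_mult[OF that(2)]] bidual_mult[OF _ that(2)] by simp
    then show "F \<in> (PiE (dual scale) (\<lambda>f. cball 0 (onorm f))) \<inter> (\<Inter>i\<in>I. C i)"
      using F by (auto simp: C_def I_def PiE_def bidual_extensional)
  qed
  ultimately show ?thesis
    unfolding weakstar_bidual_def compactin_subtopology by auto
qed

lemma bidual_lact_canon_embed: "f \<in> dual scale \<Longrightarrow> bidual_lact (canon_embed scale a) f = lact a f"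
  by (simp add: fun_eq_iff bidual_lact_apply ract_in_dual) (simp add: ract_apply lact_apply)

lemma bidual_ract_canon_embed: "f \<in> dual scale \<Longrightarrow> bidual_ract f (canon_embed scale a) = ract f a"
  by (simp add: fun_eq_iff bidual_ract_apply lact_in_dual) (simp add: ract_apply lact_apply)

text \<open>The hypothesis says that the two Arens products of any \<open>F\<close> and
  \<open>G\<close> agree at the single functional \<open>f\<close>. It is what turns
  \<open>bidual_ract f\<close> into a weak*-to-weak continuous map on the bidual.\<close>

lemma wapI:
  assumes f: "f \<in> dual scale"
    and swap: "\<And>F G. F \<in> bidual scale \<Longrightarrow> G \<in> bidual scale \<Longrightarrow>
      F (bidual_lact G f) = G (bidual_ract f F)"
  shows "f \<in> wap scale"
proof -
  let ?B = "{F \<in> bidual scale. \<forall>f\<in>dual scale. norm (F f) \<le> onorm f}"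
  have "continuous_map (weakstar_bidual scale) (weak_dual scale) (bidual_ract f)"
  proof (rule continuous_map_into_weak_dual)
    fix G assume G: "G \<in> bidual scale"
    show "continuous_map (weakstar_bidual scale) euclidean (\<lambda>F. G (bidual_ract f F))"
      \<comment> \<open>For fixed \<open>G\<close>, \<open>swap\<close> rewrites the map as
        evaluation of \<open>F\<close> at the fixed element \<open>bidual_lact G f\<close> of the
        dual, which is weak* continuous.\<close>
      using continuous_map_weakstar_bidual_eval[OF bidual_lact_in_dual[OF G f]]
      by (rule continuous_map_eq) (simp add: swap G)
  qed (simp add: bidual_ract_in_dual f)
  then have "compactin (weak_dual scale) (bidual_ract f ` ?B)"
    by (rule image_compactin[OF compactin_bidual_ball])
  moreover have "ract f a \<in> bidual_ract f ` ?B" if "norm a \<le> 1" for a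
  proof (rule image_eqI)
    show "ract f a = bidual_ract f (canon_embed scale a)"
      by (simp add: bidual_ract_canon_embed f)
    have "norm (g a) \<le> onorm g" if g: "g \<in> dual scale" for g
      using dual_norm[OF g, of a] mult_left_mono[OF \<open>norm a \<le> 1\<close> onorm_dual_nonneg[OF g]] by simp
    then show "canon_embed scale a \<in> ?B"
      by (simp add: canon_embed_in_bidual)
  qed
  ultimately have "weakly_compact_operator scale (ract f)"
    by (intro weakly_compact_operatorI[OF Hausdorff_space_weak_dual]) auto
  then show ?thesis
    using f by (simp add: wap_def)
qed

section \<open>From convergence of nets to evaluation at a point\<close>

text \<open>Treats both one-sided properties at once, with \<open>T\<close> the transpose of
  \<open>h\<close>, a right or left multiplication. If no finite set of evaluations controlled
  \<open>F (T f)\<close>, a net indexed by finite sets would converge weak* to zero under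
  \<open>T\<close> while \<open>F\<close> stays 1 along it. Hence \<open>F (T f)\<close> is a finite
  combination of evaluations, and so one evaluation.\<close>

lemma weakstar_weak_continuous_imp_evaluation:
  assumes F: "F \<in> bidual scale"
    and T: "\<And>f. T f = (\<lambda>b. f (h b))" "\<And>f. f \<in> dual scale \<Longrightarrow> T f \<in> dual scale"
    and cont: "\<And>N. N \<le> principal (dual scale) \<Longrightarrow>
      limitin (weakstar_dual scale) T (\<lambda>_. 0) N \<Longrightarrow> limitin (weak_dual scale) T (\<lambda>_. 0) N"
  shows "\<exists>z. \<forall>f\<in>dual scale. F (T f) = f z"
proof -
  have add: "F (T (\<lambda>x. f x + g x)) = F (T f) + F (T g)" if "f \<in> dual scale" "g \<in> dual scale" for f g
    using bidual_add[OF F T(2)[OF that(1)] T(2)[OF that(2)]] unfolding T(1) .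
  have mult: "F (T (\<lambda>x. k * f x)) = k * F (T f)" if "f \<in> dual scale" for f k
    using bidual_mult[OF F T(2)[OF that]] unfolding T(1) .
  have "\<exists>E. finite E \<and> (\<forall>f\<in>dual scale. (\<forall>a\<in>E. f (h a) = 0) \<longrightarrow> F (T f) = 0)"
  proof (rule ccontr)
    assume neg: "\<not> ?thesis"
    have "\<exists>f\<in>dual scale. (\<forall>a\<in>E. f (h a) = 0) \<and> F (T f) = 1" if E: "finite E" for E
    proof -
      obtain f where "f \<in> dual scale" "\<forall>a\<in>E. f (h a) = 0" "F (T f) \<noteq> 0"
        using neg E by blast
      \<comment> \<open>Homogeneity rescales \<open>f\<close> so that the value of
        \<open>F (T f)\<close> becomes 1.\<close>
      then show ?thesis
        using mult[of f "inverse (F (T f))"]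
        by (intro bexI[of _ "\<lambda>x. inverse (F (T f)) * f x"]) (auto intro: dual_mult)
    qed
    then obtain p where p: "\<And>E. finite E \<Longrightarrow>
        p E \<in> dual scale \<and> (\<forall>a\<in>E. p E (h a) = 0) \<and> F (T (p E)) = 1"
      by metis
    \<comment> \<open>The tail filter of the net \<open>p\<close>, indexed by the finite subsets of
      the algebra under inclusion. Since \<open>p\<close> is specified on finite sets only,
      \<open>ev\<close> accompanies its use.\<close>
    define N where "N = filtermap p (finite_subsets_at_top UNIV)"
    have ev: "\<forall>\<^sub>F E in finite_subsets_at_top UNIV. finite (E :: 'a set)"
      by auto
    have "limitin (weakstar_dual scale) T (\<lambda>_. 0) N"
      unfolding weakstar_dual_def limitin_subtopology limitin_componentwise
    proof (intro conjI ballI)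
      show "\<forall>\<^sub>F f in N. T f \<in> dual scale"
        unfolding N_def eventually_filtermap using ev by eventually_elim (simp add: p T(2))
      fix a
      \<comment> \<open>As soon as \<open>E\<close> contains \<open>a\<close>, the value
        \<open>T (p E) a = p E (h a)\<close> is zero, so every coordinate is eventually
        zero.\<close>
      have "\<forall>\<^sub>F E in finite_subsets_at_top UNIV. T (p E) a = 0"
        unfolding eventually_finite_subsets_at_top
        by (intro exI[of _ "{a}"]) (auto simp: T(1) p)
      then show "limitin euclidean (\<lambda>f. T f a) 0 N"
        unfolding limitin_canonical_iff N_def filterlim_filtermap by (rule tendsto_eventually)
    qed (auto simp: dual_0)
    moreover have "N \<le> principal (dual scale)"
      unfolding le_principal N_def eventually_filtermap using ev by eventually_elim (simp add: p)
    ultimately have "limitin (weak_dual scale) T (\<lambda>_. 0) N"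
      by (intro cont)
    \<comment> \<open>\<open>F\<close> is weakly continuous, so its values along the net should tend
      to 0, yet they are eventually 1.\<close>
    from continuous_map_limit[OF continuous_map_weak_dual_eval[OF F] this]
    have "((\<lambda>E. F (T (p E))) \<longlongrightarrow> 0) (finite_subsets_at_top UNIV)"
      by (simp add: N_def filterlim_filtermap o_def bidual_zero F)
    moreover have "((\<lambda>E. F (T (p E))) \<longlongrightarrow> 1) (finite_subsets_at_top UNIV)"
      by (rule tendsto_eventually) (use ev in eventually_elim, simp add: p)
    ultimately show False
      using tendsto_unique[OF finite_subsets_at_top_neq_bot] zero_neq_one by blast
  qed
  then obtain E where E: "finite E"
    "\<And>f. f \<in> dual scale \<Longrightarrow> \<forall>a\<in>h ` E. f a = 0 \<Longrightarrow> F (T f) = 0"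
    by auto
  obtain u where u: "\<forall>f\<in>dual scale. F (T f) = (\<Sum>a\<in>h ` E. u a * f a)"
    using functional_in_span_of_evaluations[where S = "dual scale" and p = "\<lambda>f. F (T f)"
        and E = "h ` E", OF _ dual_plus dual_mult add mult] E by blast
  then show ?thesis
    \<comment> \<open>By linearity of \<open>f\<close>, the combination of evaluations is evaluation
      at the same combination of points.\<close>
    by (intro exI[of _ "\<Sum>a\<in>h ` E. scale (u a) a"]) (simp add: dual_sum dual_scale)
qed

lemma LWsW_imp_evaluation:
  assumes "LWsW scale c" "F \<in> bidual scale"
  shows "\<exists>z. \<forall>f\<in>dual scale. F (lact c f) = f z"
  using assms by (intro weakstar_weak_continuous_imp_evaluation[where h = "\<lambda>b. b * c"])
    (auto simp: lact_in_dual LWsW_def, simp add: lact_def)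

lemma RWsW_imp_evaluation:
  assumes "RWsW scale c" "F \<in> bidual scale"
  shows "\<exists>z. \<forall>f\<in>dual scale. F (ract f c) = f z"
  using assms by (intro weakstar_weak_continuous_imp_evaluation[where h = "\<lambda>b. c * b"])
    (auto simp: ract_in_dual RWsW_def, simp add: ract_def)

section \<open>Arens products with elements of the algebra, and the topological centers\<close>

lemma arens1_canon_embed_left:
  "F \<in> bidual scale \<Longrightarrow> arens1 scale (canon_embed scale a) F = (\<lambda>f\<in>dual scale. F (ract f a))"
  by (auto simp: arens1_def bidual_lact_in_dual bidual_lact_apply)

lemma arens1_canon_embed_right:
  "arens1 scale F (canon_embed scale a) = (\<lambda>f\<in>dual scale. F (lact a f))"
  by (auto simp: arens1_def bidual_lact_canon_embed)

text \<open>Together with \<open>arens1_canon_embed_right\<close>, this shows that both products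
  agree when the right factor comes from the algebra.\<close>

lemma arens2_canon_embed_right:
  "F \<in> bidual scale \<Longrightarrow> arens2 scale F (canon_embed scale a) = (\<lambda>f\<in>dual scale. F (lact a f))"
  by (auto simp: arens2_def bidual_ract_in_dual bidual_ract_apply)

text \<open>Products with an embedded element on the left have this form; membership in the bidual
  makes them legitimate values of a map into \<open>weakstar_bidual\<close>.\<close>

lemma bidual_comp_ract:
  assumes "F \<in> bidual scale"
  shows "(\<lambda>f\<in>dual scale. F (ract f a)) \<in> bidual scale"
proof -
  obtain K where K: "0 \<le> K" "\<And>f. f \<in> dual scale \<Longrightarrow> norm (F f) \<le> K * onorm f"
    using bidual_bound[OF assms(1)] by blast
  show ?thesis
  proof (rule bidualI[where K = "K * norm a"])
    fix f assume f: "f \<in> dual scale"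
    show "norm ((\<lambda>f\<in>dual scale. F (ract f a)) f) \<le> K * norm a * onorm f"
      using order_trans[OF K(2)[OF ract_in_dual[OF f]] mult_left_mono[OF onorm_ract_le[OF f] K(1)]] f
      by (simp add: ac_simps)
    show "(\<lambda>f\<in>dual scale. F (ract f a)) (\<lambda>x. k * f x) = k * (\<lambda>f\<in>dual scale. F (ract f a)) f" for k
      using bidual_mult[OF assms ract_in_dual[OF f]] f by (simp add: dual_mult) (simp add: ract_def)
    fix g assume g: "g \<in> dual scale"
    show "(\<lambda>f\<in>dual scale. F (ract f a)) (\<lambda>x. f x + g x) =
        (\<lambda>f\<in>dual scale. F (ract f a)) f + (\<lambda>f\<in>dual scale. F (ract f a)) g"
      using bidual_add[OF assms ract_in_dual[OF f] ract_in_dual[OF g]] f g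
      by (simp add: dual_plus) (simp add: ract_def)
  qed simp
qed

lemma bidual_comp_lact:
  assumes "F \<in> bidual scale"
  shows "(\<lambda>f\<in>dual scale. F (lact a f)) \<in> bidual scale"
proof -
  obtain K where K: "0 \<le> K" "\<And>f. f \<in> dual scale \<Longrightarrow> norm (F f) \<le> K * onorm f"
    using bidual_bound[OF assms(1)] by blast
  show ?thesis
  proof (rule bidualI[where K = "K * norm a"])
    fix f assume f: "f \<in> dual scale"
    show "norm ((\<lambda>f\<in>dual scale. F (lact a f)) f) \<le> K * norm a * onorm f"
      using order_trans[OF K(2)[OF lact_in_dual[OF f]] mult_left_mono[OF onorm_lact_le[OF f] K(1)]] f
      by (simp add: ac_simps)
    show "(\<lambda>f\<in>dual scale. F (lact a f)) (\<lambda>x. k * f x) = k * (\<lambda>f\<in>dual scale. F (lact a f)) f" for k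
      using bidual_mult[OF assms lact_in_dual[OF f]] f by (simp add: dual_mult) (simp add: lact_def)
    fix g assume g: "g \<in> dual scale"
    show "(\<lambda>f\<in>dual scale. F (lact a f)) (\<lambda>x. f x + g x) =
        (\<lambda>f\<in>dual scale. F (lact a f)) f + (\<lambda>f\<in>dual scale. F (lact a f)) g"
      using bidual_add[OF assms lact_in_dual[OF f] lact_in_dual[OF g]] f g
      by (simp add: dual_plus) (simp add: lact_def)
  qed simp
qed

text \<open>The product with \<open>F\<close>, tested at \<open>f\<close>, is \<open>F\<close>
  evaluated at \<open>ract f a\<close>, an element of the dual fixed in advance; such evaluations
  are weak* continuous.\<close>

lemma canon_embed_in_Z1: "canon_embed scale a \<in> Z1 scale"
proof -
  have "continuous_map (weakstar_bidual scale) (weakstar_bidual scale)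
      (\<lambda>F. \<lambda>f\<in>dual scale. F (ract f a))"
    by (rule continuous_map_into_weakstar_bidual)
      (simp_all add: bidual_comp_ract continuous_map_weakstar_bidual_eval ract_in_dual)
  then have "continuous_map (weakstar_bidual scale) (weakstar_bidual scale)
      (arens1 scale (canon_embed scale a))"
    by (rule continuous_map_eq) (simp add: arens1_canon_embed_left)
  then show ?thesis
    by (simp add: Z1_def canon_embed_in_bidual)
qed

lemma canon_embed_in_Z2: "canon_embed scale a \<in> Z2 scale"
proof -
  have "continuous_map (weakstar_bidual scale) (weakstar_bidual scale)
      (\<lambda>F. \<lambda>f\<in>dual scale. F (lact a f))"
    by (rule continuous_map_into_weakstar_bidual)
      (simp_all add: bidual_comp_lact continuous_map_weakstar_bidual_eval lact_in_dual)
  then have "continuous_map (weakstar_bidual scale) (weakstar_bidual scale)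
      (\<lambda>F. arens2 scale F (canon_embed scale a))"
    by (rule continuous_map_eq) (simp add: arens2_canon_embed_right)
  then show ?thesis
    by (simp add: Z2_def canon_embed_in_bidual)
qed

text \<open>Evaluation at \<open>z\<close> on the dual is the embedded \<open>z\<close>, so
  \<open>LWsW_imp_evaluation\<close> places F.c in the algebra.\<close>

lemma LWsW_arens1_in_range_canon_embed:
  assumes "LWsW scale c" "F \<in> bidual scale"
  shows "arens1 scale F (canon_embed scale c) \<in> range (canon_embed scale)"
proof -
  obtain z where "\<And>f. f \<in> dual scale \<Longrightarrow> F (lact c f) = f z"
    using LWsW_imp_evaluation[OF assms] by blast
  then have "arens1 scale F (canon_embed scale c) = canon_embed scale z"
    by (auto simp: arens1_canon_embed_right canon_embed_def[of scale z])
  then show ?thesis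
    by simp
qed

lemma RWsW_arens1_in_range_canon_embed:
  assumes "RWsW scale c" "F \<in> bidual scale"
  shows "arens1 scale (canon_embed scale c) F \<in> range (canon_embed scale)"
proof -
  obtain z where "\<And>f. f \<in> dual scale \<Longrightarrow> F (ract f c) = f z"
    using RWsW_imp_evaluation[OF assms] by blast
  then have "arens1 scale (canon_embed scale c) F = canon_embed scale z"
    by (auto simp: arens1_canon_embed_left[OF assms(2)] canon_embed_def[of scale z])
  then show ?thesis
    by simp
qed

section \<open>Arens regularity and weakly almost periodic functionals\<close>

text \<open>Write G = c.H and F.c = z with z in the algebra. Reassociating gives z.H for both
  products, since each takes the value \<open>H (ract f z)\<close> at \<open>f\<close>.\<close>

lemma LWsW_arens_regular:
  assumes c: "LWsW scale c"
    and surj: "bidual scale \<subseteq> arens1 scale (canon_embed scale c) ` bidual scale"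
  shows "arens_regular scale"
  unfolding arens_regular_def
proof (intro ballI)
  fix F G assume F: "F \<in> bidual scale" and G: "G \<in> bidual scale"
  from G surj obtain H where H: "H \<in> bidual scale"
    and G_eq: "G = (\<lambda>f\<in>dual scale. H (ract f c))"
    by (auto simp: arens1_canon_embed_left)
  obtain z where z: "\<And>f. f \<in> dual scale \<Longrightarrow> F (lact c f) = f z"
    using LWsW_imp_evaluation[OF c F] by blast
  have "F (bidual_lact G f) = G (bidual_ract f F)" if f: "f \<in> dual scale" for f
  proof -
    have "bidual_lact G f = lact c (bidual_lact H f)"
      by (simp add: fun_eq_iff bidual_lact_apply lact_apply G_eq ract_in_dual f ract_ract)
    then have "F (bidual_lact G f) = H (ract f z)"
      by (simp add: z bidual_lact_in_dual H f) (simp add: bidual_lact_apply)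
    \<comment> \<open>At \<open>b\<close> the left side is \<open>F (lact (c * b) f)\<close>;
      splitting off \<open>c\<close> exposes \<open>F (lact c (lact b f))\<close>, which
      \<open>z\<close> evaluates.\<close>
    moreover have "ract (bidual_ract f F) c = ract f z"
      by (simp add: fun_eq_iff ract_apply bidual_ract_apply lact_lact[symmetric] z lact_in_dual f)
        (simp add: lact_apply)
    ultimately show ?thesis
      by (simp add: G_eq bidual_ract_in_dual F f)
  qed
  then show "arens1 scale F G = arens2 scale F G"
    by (auto simp: arens1_def arens2_def)
qed

text \<open>Mirror image: with F = H.c and c.G = z, both products take the value
  \<open>H (lact z f)\<close> at \<open>f\<close>.\<close>

lemma RWsW_arens_regular:
  assumes c: "RWsW scale c"
    and surj: "bidual scale \<subseteq> (\<lambda>F. arens1 scale F (canon_embed scale c)) ` bidual scale"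
  shows "arens_regular scale"
  unfolding arens_regular_def
proof (intro ballI)
  fix F G assume F: "F \<in> bidual scale" and G: "G \<in> bidual scale"
  from F surj obtain H where H: "H \<in> bidual scale"
    and F_eq: "F = (\<lambda>f\<in>dual scale. H (lact c f))"
    by (auto simp: arens1_canon_embed_right)
  obtain z where z: "\<And>f. f \<in> dual scale \<Longrightarrow> G (ract f c) = f z"
    using RWsW_imp_evaluation[OF c G] by blast
  have "F (bidual_lact G f) = G (bidual_ract f F)" if f: "f \<in> dual scale" for f
  proof -
    have "bidual_ract f F = ract (bidual_ract f H) c"
      by (simp add: fun_eq_iff bidual_ract_apply ract_apply F_eq lact_in_dual f lact_lact)
    then have "G (bidual_ract f F) = H (lact z f)"
      by (simp add: z bidual_ract_in_dual H f) (simp add: bidual_ract_apply)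
    moreover have "lact c (bidual_lact G f) = lact z f"
      by (simp add: fun_eq_iff lact_apply bidual_lact_apply ract_ract[symmetric] z ract_in_dual f)
        (simp add: ract_apply)
    ultimately show ?thesis
      by (simp add: F_eq bidual_lact_in_dual G f)
  qed
  then show "arens1 scale F G = arens2 scale F G"
    by (auto simp: arens1_def arens2_def)
qed

text \<open>With G.c = z in the algebra, both sides of the identity required by \<open>wapI\<close>
  equal \<open>F (lact z g)\<close>: the factor \<open>c\<close> in front of \<open>g\<close> is
  absorbed into \<open>G\<close>.\<close>

lemma LWsW_lact_in_wap:
  assumes c: "LWsW scale c" and g: "g \<in> dual scale"
  shows "lact c g \<in> wap scale"
proof (rule wapI)
  fix F G assume F: "F \<in> bidual scale" and G: "G \<in> bidual scale"
  obtain z where z: "\<And>f. f \<in> dual scale \<Longrightarrow> G (lact c f) = f z"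
    using LWsW_imp_evaluation[OF c G] by blast
  have "bidual_lact G (lact c g) = lact z g"
    by (simp add: fun_eq_iff bidual_lact_apply ract_lact z ract_in_dual g) (simp add: ract_apply lact_apply)
  moreover have "bidual_ract (lact c g) F = lact c (bidual_ract g F)"
    by (simp add: fun_eq_iff bidual_ract_apply lact_apply lact_lact)
  then have "G (bidual_ract (lact c g) F) = F (lact z g)"
    by (simp add: z bidual_ract_in_dual F g) (simp add: bidual_ract_apply)
  ultimately show "F (bidual_lact G (lact c g)) = G (bidual_ract (lact c g) F)"
    by simp
qed (simp add: lact_in_dual g)

text \<open>Here it is \<open>F\<close> that absorbs \<open>c\<close>: with c.F = z, both sides of
  the identity equal \<open>G (ract g z)\<close>.\<close>

lemma RWsW_ract_in_wap:
  assumes c: "RWsW scale c" and g: "g \<in> dual scale"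
  shows "ract g c \<in> wap scale"
proof (rule wapI)
  fix F G assume F: "F \<in> bidual scale" and G: "G \<in> bidual scale"
  obtain z where z: "\<And>f. f \<in> dual scale \<Longrightarrow> F (ract f c) = f z"
    using RWsW_imp_evaluation[OF c F] by blast
  have "bidual_ract (ract g c) F = ract g z"
    by (simp add: fun_eq_iff bidual_ract_apply ract_lact[symmetric] z lact_in_dual g)
      (simp add: ract_apply lact_apply)
  moreover have "bidual_lact G (ract g c) = ract (bidual_lact G g) c"
    by (simp add: fun_eq_iff bidual_lact_apply ract_apply ract_ract)
  then have "F (bidual_lact G (ract g c)) = G (ract g z)"
    by (simp add: z bidual_lact_in_dual G g) (simp add: bidual_lact_apply)
  ultimately show "F (bidual_lact G (ract g c)) = G (bidual_ract (ract g c) F)"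
    by simp
qed (simp add: ract_in_dual g)

end

theorem theorem10:
  fixes s :: "'k::{real_normed_field,heine_borel} \<Rightarrow> 'a::{real_normed_algebra,banach} \<Rightarrow> 'a"
    and c :: 'a
  assumes "banach_algebra s"
  shows "(bidual s = (\<lambda>F. arens1 s (canon_embed s c) F) ` bidual s \<and> LWsW s c \<longrightarrow> arens_regular s) \<and>
    (bidual s = (\<lambda>F. arens1 s F (canon_embed s c)) ` bidual s \<and> RWsW s c \<longrightarrow> arens_regular s) \<and>
    (dual s = (\<lambda>f. ract f c) ` dual s \<and> LWsW s c \<longrightarrow>
       (\<lambda>F. arens1 s F (canon_embed s c)) ` bidual s \<subseteq> Z1 s \<inter> Z2 s \<and>
       (\<lambda>f. lact c f) ` dual s \<subseteq> wap s \<and> wap s \<subseteq> (\<lambda>f. ract f c) ` dual s) \<and>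
    (dual s = (\<lambda>f. lact c f) ` dual s \<and> RWsW s c \<longrightarrow>
       (\<lambda>F. arens1 s (canon_embed s c) F) ` bidual s \<subseteq> Z1 s \<inter> Z2 s \<and>
       (\<lambda>f. ract f c) ` dual s \<subseteq> wap s \<and> wap s \<subseteq> (\<lambda>f. lact c f) ` dual s)"
proof -
  interpret banach_algebra s
    by (rule assms)
  \<comment> \<open>Reduces the inclusions into the centers to F.c or c.F lying in the
    algebra.\<close>
  have A_central: "range (canon_embed s) \<subseteq> Z1 s \<inter> Z2 s"
    using canon_embed_in_Z1 canon_embed_in_Z2 by blast
  \<comment> \<open>The upper bounds on \<open>wap s\<close> follow from this, because the
    factorization hypotheses equate their right sides with the whole dual.\<close>
  have wap_dual: "wap s \<subseteq> dual s"
    by (auto simp: wap_def)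
  show ?thesis
  proof (intro conjI impI; elim conjE)
    assume c: "LWsW s c"
    show "arens_regular s" if "bidual s = (\<lambda>F. arens1 s (canon_embed s c) F) ` bidual s"
      using LWsW_arens_regular[OF c] that by simp
    show "(\<lambda>F. arens1 s F (canon_embed s c)) ` bidual s \<subseteq> Z1 s \<inter> Z2 s"
      using LWsW_arens1_in_range_canon_embed[OF c] A_central by blast
    show "(\<lambda>f. lact c f) ` dual s \<subseteq> wap s"
      using LWsW_lact_in_wap[OF c] by blast
    show "wap s \<subseteq> (\<lambda>f. ract f c) ` dual s" if "dual s = (\<lambda>f. ract f c) ` dual s"
      using wap_dual that by simp
  next
    assume c: "RWsW s c"
    show "arens_regular s" if "bidual s = (\<lambda>F. arens1 s F (canon_embed s c)) ` bidual s"
      using RWsW_arens_regular[OF c] that by simp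
    show "(\<lambda>F. arens1 s (canon_embed s c) F) ` bidual s \<subseteq> Z1 s \<inter> Z2 s"
      using RWsW_arens1_in_range_canon_embed[OF c] A_central by blast
    show "(\<lambda>f. ract f c) ` dual s \<subseteq> wap s"
      using RWsW_ract_in_wap[OF c] by blast
    show "wap s \<subseteq> (\<lambda>f. lact c f) ` dual s" if "dual s = (\<lambda>f. lact c f) ` dual s"
      using wap_dual that by simp
  qed
qed

end
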